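(* Let $r>1$ and $0=m_0<m_1<\cdots<m_{r-1}<m_r=n$ be integers, let $d_1,\ldots,d_n$ be positive integers, and set $$D_i:=\sum_{k=m_{i-1}+1}^{m_i}d_ke_k^\tau,\quad1\le i\le r.$$ Assume furthermore that $d_{m_{i-1}+1},\ldots,d_{m_i}$ are relatively prime for each $i\in\{1,\ldots,r\}$. Let $\mu_1,\ldots,\mu_n\in\mathbb C$, $\mu=(\mu_1,\ldots,\mu_n)$, be such that $$\langle D_1,\mu\rangle=\cdots=\langle D_r,\mu\rangle=0;\qquad\dim_{\mathbb Q}(\mathbb Q\mu_1+\cdots+\mathbb Q\mu_n)=n-r.$$ Then the following hold for $B:=\mathrm{diag}(\mu_1,\ldots,\mu_n)$: (a) $I(B)$ is generated (as an algebra) by the algebraically independent monomials $\phi_i(x):=x^{D_i}$, $1\le i\le r$. (b) The $I(B)$-module $\mathcal C^{\rm pol}(B)$ is generated by the $Q_j(x)=x_je_j$, $1\le j\le n$, and is free.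
   Context: $e_k$ is the $k$-th standard basis (column) vector of $\mathbb C^n$, $e_k^\tau$ its transpose; $\langle m,\mu\rangle=\sum m_i\mu_i$; $x^{m}=x_1^{m_1}\cdots x_n^{m_n}$ for a row $m=(m_1,\ldots,m_n)$ of nonnegative integers. $[g,h](x)=Dh(x)g(x)-Dg(x)h(x)$, $X_g(\phi)(x)=D\phi(x)g(x)$; a matrix $B$ is identified with the vector field $x\mapsto Bx$. $$I(B)=\{\phi\in\mathbb C[x_1,\ldots,x_n];\ X_B(\phi)=0\},\qquad\mathcal C^{\rm pol}(B)=\{g\in\mathbb C[x_1,\ldots,x_n]^n;\ [B,g]=0\}.$$
   Formalization: In (b), generation by the Q_j is stated only when every block m_{i-1}+1,…,m_i has at least two indices; for a one-index block {k} one gets d_k=1, μ_k=0 and e_k commutes with B but is not generated (e.g. r=n=2, μ=0). Part (a) and freeness are unconditional. *)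

theory Defs
  imports Complex_Main "HOL-Library.Poly_Mapping"
begin

(* Polynomials over the complex numbers in the variables x_1, x_2, ...: finitely supported
   maps from exponents (themselves finitely supported maps from variable indices to nat) to
   coefficients, with the convolution product. *)

type_synonym cpoly = "(nat \<Rightarrow>\<^sub>0 nat) \<Rightarrow>\<^sub>0 complex"

definition polys :: "nat \<Rightarrow> cpoly set" where
  "polys n = {p. \<forall>a \<in> Poly_Mapping.keys p. Poly_Mapping.keys a \<subseteq> {1..n}}"

definition const :: "complex \<Rightarrow> cpoly" where
  "const c = Poly_Mapping.single 0 c"

definition var :: "nat \<Rightarrow> cpoly" where
  "var k = Poly_Mapping.single (Poly_Mapping.single k 1) 1"

definition monomial :: "nat \<Rightarrow> (nat \<Rightarrow> nat) \<Rightarrow> cpoly" where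
  "monomial n m = (\<Prod>k=1..n. var k ^ m k)"

(* Terms whose exponent a does not contain x_k contribute 0 because lookup a k = 0, so the
   truncated subtraction of exponents is harmless. *)
definition pderiv_var :: "nat \<Rightarrow> cpoly \<Rightarrow> cpoly" where
  "pderiv_var k p =
     (\<Sum>a\<in>Poly_Mapping.keys p.
        Poly_Mapping.single (a - Poly_Mapping.single k 1)
          (of_nat (Poly_Mapping.lookup a k) * Poly_Mapping.lookup p a))"

(* Substitution of polynomials f 1, ..., f r for the variables of a polynomial in polys r. *)
definition subst_poly :: "nat \<Rightarrow> (nat \<Rightarrow> cpoly) \<Rightarrow> cpoly \<Rightarrow> cpoly" where
  "subst_poly r f p =
     (\<Sum>a\<in>Poly_Mapping.keys p.
        const (Poly_Mapping.lookup p a) * (\<Prod>i=1..r. f i ^ Poly_Mapping.lookup a i))"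

definition alg_independent :: "nat \<Rightarrow> (nat \<Rightarrow> cpoly) \<Rightarrow> bool" where
  "alg_independent r f \<longleftrightarrow> (\<forall>p \<in> polys r. subst_poly r f p = 0 \<longrightarrow> p = 0)"

inductive_set generated_algebra :: "cpoly set \<Rightarrow> cpoly set" for S :: "cpoly set" where
  const: "const c \<in> generated_algebra S"
| gen: "p \<in> S \<Longrightarrow> p \<in> generated_algebra S"
| add: "p \<in> generated_algebra S \<Longrightarrow> q \<in> generated_algebra S \<Longrightarrow> p + q \<in> generated_algebra S"
| mult: "p \<in> generated_algebra S \<Longrightarrow> q \<in> generated_algebra S \<Longrightarrow> p * q \<in> generated_algebra S"

(* Elements of C[x_1,...,x_n]^n are sequences of polynomials indexed by 1..n and padded with 0,
   so that equality of functions is equality of vector fields. *)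

type_synonym vfield = "nat \<Rightarrow> cpoly"

definition vfields :: "nat \<Rightarrow> vfield set" where
  "vfields n = {g. (\<forall>k\<in>{1..n}. g k \<in> polys n) \<and> (\<forall>k. k \<notin> {1..n} \<longrightarrow> g k = 0)}"

definition lie_deriv :: "nat \<Rightarrow> vfield \<Rightarrow> cpoly \<Rightarrow> cpoly" where
  "lie_deriv n g \<phi> = (\<Sum>k=1..n. pderiv_var k \<phi> * g k)"

(* The i-th entry of Dh g is lie_deriv n g (h i). *)
definition lie_bracket :: "nat \<Rightarrow> vfield \<Rightarrow> vfield \<Rightarrow> vfield" where
  "lie_bracket n g h = (\<lambda>i. lie_deriv n g (h i) - lie_deriv n h (g i))"

definition linear_vfield :: "nat \<Rightarrow> (nat \<Rightarrow> nat \<Rightarrow> complex) \<Rightarrow> vfield" where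
  "linear_vfield n B = (\<lambda>i. if i \<in> {1..n} then \<Sum>j=1..n. const (B i j) * var j else 0)"

definition diag :: "(nat \<Rightarrow> complex) \<Rightarrow> nat \<Rightarrow> nat \<Rightarrow> complex" where
  "diag \<mu> = (\<lambda>i j. if i = j then \<mu> i else 0)"

definition first_integrals :: "nat \<Rightarrow> (nat \<Rightarrow> nat \<Rightarrow> complex) \<Rightarrow> cpoly set" where
  "first_integrals n B = {\<phi> \<in> polys n. lie_deriv n (linear_vfield n B) \<phi> = 0}"

definition pol_centralizer :: "nat \<Rightarrow> (nat \<Rightarrow> nat \<Rightarrow> complex) \<Rightarrow> vfield set" where
  "pol_centralizer n B = {g \<in> vfields n. lie_bracket n (linear_vfield n B) g = (\<lambda>_. 0)}"

(* Modules of vector fields over a ring R of polynomials, acting by multiplication in each entry. *)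

definition generated_module :: "cpoly set \<Rightarrow> vfield set \<Rightarrow> vfield set" where
  "generated_module R S =
     {(\<lambda>k. \<Sum>s\<in>T. c s * s k) | c T. finite T \<and> T \<subseteq> S \<and> (\<forall>s\<in>T. c s \<in> R)}"

definition lin_independent :: "cpoly set \<Rightarrow> vfield set \<Rightarrow> bool" where
  "lin_independent R S \<longleftrightarrow>
     (\<forall>T c. finite T \<and> T \<subseteq> S \<and> (\<forall>s\<in>T. c s \<in> R) \<and> (\<forall>k. (\<Sum>s\<in>T. c s * s k) = 0)
        \<longrightarrow> (\<forall>s\<in>T. c s = 0))"

definition free_module :: "cpoly set \<Rightarrow> vfield set \<Rightarrow> bool" where
  "free_module R M \<longleftrightarrow> (\<exists>S. lin_independent R S \<and> M = generated_module R S)"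

definition Q_field :: "nat \<Rightarrow> vfield" where
  "Q_field j = (\<lambda>k. if k = j then var j else 0)"

definition unit_row :: "nat \<Rightarrow> nat \<Rightarrow> nat" where
  "unit_row k = (\<lambda>l. if l = k then 1 else 0)"

(* If the i-th block is a single index k, relative primality forces d k = 1, so block_row m d i is
   the k-th unit row and its orthogonality to mu means mu k = 0. The constant field e_k then
   commutes with diag mu, although it is no combination of the fields x_j e_j. *)
definition block_row :: "(nat \<Rightarrow> nat) \<Rightarrow> (nat \<Rightarrow> nat) \<Rightarrow> nat \<Rightarrow> nat \<Rightarrow> nat" where
  "block_row m d i = (\<lambda>l. \<Sum>k = m (i - 1) + 1..m i. d k * unit_row k l)"

definition pairing :: "nat \<Rightarrow> (nat \<Rightarrow> nat) \<Rightarrow> (nat \<Rightarrow> complex) \<Rightarrow> complex" where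
  "pairing n m \<mu> = (\<Sum>k=1..n. of_nat (m k) * \<mu> k)"

global_interpretation Q: vector_space "\<lambda>(q::rat) (z::complex). of_rat q * z"
  by unfold_locales (simp_all add: algebra_simps of_rat_add of_rat_mult)

end

(* A monomial x^a is an eigenvector of X_B with eigenvalue <a, mu>, so everything is decided by the
   integer relations among the mu_k. The r rows D_i are independent relations and the dimension
   hypothesis leaves room for no others over Q; by primality within a block, an integer relation
   is an integer combination of the D_i, and it is nonnegative as soon as one of its entries in each
   block is. Hence I(B) is spanned by the products of the x^{D_i}. A term x^a e_j of the centralizer
   satisfies <a - e_j, mu> = 0, and unless j is alone in its block, another entry of that block
   forces a_j > 0, so that x_j divides it. *)
theory Submission
  imports Defs
begin

section \<open>Rational and integer relations among the \<open>\<mu> k\<close>\<close>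

text \<open>A nonzero coefficient would put \<open>\<mu> j\<close> into the span of the other
  values, leaving a spanning family with fewer members than the dimension. Members are counted by
  index, so coinciding values need no separate case.\<close>

lemma rational_relation_trivial:
  fixes \<mu> :: "nat \<Rightarrow> complex" and c :: "nat \<Rightarrow> rat"
  assumes fin: "finite N" and spans: "\<mu> ` A \<subseteq> Q.span (\<mu> ` N)"
    and dim: "Q.dim (Q.span (\<mu> ` A)) = card N"
    and rel: "(\<Sum>k\<in>N. of_rat (c k) * \<mu> k) = 0" and j: "j \<in> N"
  shows "c j = 0"
proof (rule ccontr)
  assume cj: "c j \<noteq> 0"
  let ?S = "Q.span (\<mu> ` (N - {j}))"
  have "of_rat (c j) * \<mu> j = - (\<Sum>k\<in>N - {j}. of_rat (c k) * \<mu> k)"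
    using rel by (simp add: sum.remove[OF fin j] eq_neg_iff_add_eq_0)
  moreover have "- (\<Sum>k\<in>N - {j}. of_rat (c k) * \<mu> k) \<in> ?S"
    by (intro Q.span_neg Q.span_sum Q.span_scale Q.span_base) auto
  ultimately have "of_rat (1 / c j) * (of_rat (c j) * \<mu> j) \<in> ?S"
    using Q.span_scale by metis
  then have "\<mu> j \<in> ?S"
    using cj by (simp add: of_rat_divide)
  then have "\<mu> ` N \<subseteq> ?S"
    using Q.span_superset[of "\<mu> ` (N - {j})"] by blast
  then have "Q.span (\<mu> ` A) \<subseteq> ?S"
    by (intro Q.span_minimal subset_trans[OF spans]) (auto intro: Q.subspace_span)
  then have "Q.dim (Q.span (\<mu> ` A)) \<le> card (\<mu> ` (N - {j}))"
    using fin by (intro Q.dim_le_card) auto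
  also have "\<dots> \<le> card (N - {j})"
    using fin by (simp add: card_image_le)
  also have "\<dots> < card N"
    using fin j by (metis card_Diff1_less)
  finally show False
    using dim by simp
qed

lemma block_row_apply:
  "block_row m d i l = (if l \<in> {m (i - 1) + 1..m i} then d l else 0)"
  by (simp add: block_row_def unit_row_def if_distrib sum.delta cong: if_cong)

locale resonance =
  fixes r n :: nat and m d :: "nat \<Rightarrow> nat" and \<mu> :: "nat \<Rightarrow> complex"
  assumes m_0: "m 0 = 0" and m_less: "\<And>i. i < r \<Longrightarrow> m i < m (Suc i)" and m_r: "m r = n"
    and d_pos: "\<And>k. k \<in> {1..n} \<Longrightarrow> d k > 0"
    and Gcd_block: "\<And>i. i \<in> {1..r} \<Longrightarrow> Gcd (d ` {m (i - 1) + 1..m i}) = 1"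
    and pairing_block: "\<And>i. i \<in> {1..r} \<Longrightarrow> pairing n (block_row m d i) \<mu> = 0"
    and dim_span: "Q.dim (Q.span (\<mu> ` {1..n})) = n - r"
begin

abbreviation D :: "nat \<Rightarrow> nat \<Rightarrow> nat" where
  "D \<equiv> block_row m d"

text \<open>As \<open>m\<close> increases up to \<open>r\<close>, the first block end not before
  \<open>k\<close> is that of the block containing \<open>k\<close>, for \<open>k\<close> in
  \<open>{1..n}\<close>.\<close>

definition blk :: "nat \<Rightarrow> nat" where
  "blk k = (LEAST i. k \<le> m i)"

lemma m_strict_mono: "i < j \<Longrightarrow> j \<le> r \<Longrightarrow> m i < m j"
proof (induction j)
  case (Suc j)
  then show ?case
    using m_less[of j] by (cases "i = j") auto
qed simp

lemma m_mono: "i \<le> j \<Longrightarrow> j \<le> r \<Longrightarrow> m i \<le> m j"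
  using m_strict_mono[of i j] by (cases "i = j") auto

lemma blk_in:
  assumes "k \<in> {1..n}"
  shows "blk k \<in> {1..r}" "k \<in> {m (blk k - 1) + 1..m (blk k)}"
proof -
  have "k \<le> m r"
    using assms m_r by simp
  then have le: "k \<le> m (blk k)" "blk k \<le> r"
    unfolding blk_def by (auto intro: LeastI Least_le)
  have "blk k \<noteq> 0"
    using le(1) assms m_0 by (metis atLeastAtMost_iff le_zero_eq not_one_le_zero)
  moreover have "\<not> k \<le> m (blk k - 1)"
    using not_less_Least[of "blk k - 1" "\<lambda>i. k \<le> m i"] \<open>blk k \<noteq> 0\<close> by (simp add: blk_def)
  ultimately show "blk k \<in> {1..r}" "k \<in> {m (blk k - 1) + 1..m (blk k)}"
    using le by auto
qed

text \<open>Replaces interval arithmetic by the fibres of \<open>blk\<close>; monotonicity of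
  \<open>m\<close> keeps distinct blocks apart.\<close>

lemma block_iff:
  assumes "i \<in> {1..r}"
  shows "k \<in> {m (i - 1) + 1..m i} \<longleftrightarrow> k \<in> {1..n} \<and> blk k = i"
proof
  assume k: "k \<in> {m (i - 1) + 1..m i}"
  then have "k \<in> {1..n}"
    using assms m_mono[of i r] m_r by auto
  moreover have "blk k = i"
    unfolding blk_def
  proof (rule Least_equality)
    fix j assume "k \<le> m j"
    then have "\<not> j \<le> i - 1"
      using k assms m_mono[of j "i - 1"] by fastforce
    then show "i \<le> j"
      by simp
  qed (use k in auto)
  ultimately show "k \<in> {1..n} \<and> blk k = i" ..
qed (use blk_in in auto)

lemma D_apply: "i \<in> {1..r} \<Longrightarrow> k \<in> {1..n} \<Longrightarrow> D i k = (if blk k = i then d k else 0)"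
  by (simp only: block_row_apply block_iff simp_thms)

text \<open>Strict growth of \<open>m\<close> makes every block nonempty; its last index
  \<open>m i\<close> acts as the pivot of block \<open>i\<close> from here on.\<close>

lemma m_block: "i \<in> {1..r} \<Longrightarrow> m i \<in> {1..n} \<and> blk (m i) = i"
  using m_strict_mono[of "i - 1" i] by (subst block_iff[symmetric]) auto

text \<open>The rows \<open>D i\<close> have disjoint supports, so only the row of the block of
  \<open>k\<close> contributes.\<close>

lemma sum_D:
  fixes c :: "nat \<Rightarrow> 'a::comm_semiring_1"
  assumes "k \<in> {1..n}"
  shows "(\<Sum>i=1..r. c i * of_nat (D i k)) = c (blk k) * of_nat (d k)"
proof -
  have "(\<Sum>i=1..r. c i * of_nat (D i k)) = (\<Sum>i=1..r. if i = blk k then c i * of_nat (d k) else 0)"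
    using assms by (intro sum.cong refl) (auto simp: D_apply simp del: atLeastAtMost_iff)
  then show ?thesis
    using blk_in(1)[OF assms] by simp
qed

lemma sum_block_relation: "(\<Sum>k=1..n. c (blk k) * of_nat (d k) * \<mu> k) = 0"
proof -
  have "(\<Sum>k=1..n. c (blk k) * of_nat (d k) * \<mu> k)
      = (\<Sum>k=1..n. \<Sum>i=1..r. c i * of_nat (D i k) * \<mu> k)"
    by (intro sum.cong refl) (simp add: sum_D[symmetric] sum_distrib_right)
  also have "\<dots> = (\<Sum>i=1..r. c i * pairing n (D i) \<mu>)"
    by (subst sum.swap) (simp add: pairing_def sum_distrib_left mult.assoc)
  finally show ?thesis
    by (simp add: pairing_block)
qed

text \<open>Each block loses its pivot, whose value the relation of the block expresses by the
  others; the \<open>n - r\<close> remaining indices match the dimension of the span.\<close>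

definition nonpivots :: "nat set" where
  "nonpivots = {1..n} - m ` {1..r}"

lemma card_nonpivots: "card nonpivots = n - r"
proof -
  have "inj_on m {1..r}"
    using m_block by (metis inj_onI)
  moreover have "m ` {1..r} \<subseteq> {1..n}"
    using m_block by blast
  ultimately show ?thesis
    by (simp add: nonpivots_def card_Diff_subset card_image)
qed

text \<open>Solving the relation of block \<open>i\<close> for its pivot \<open>k\<close> only takes
  division by \<open>d k\<close>, and all other indices of the block are nonpivots.\<close>

lemma mu_in_span_nonpivots: "\<mu> ` {1..n} \<subseteq> Q.span (\<mu> ` nonpivots)"
proof safe
  fix k assume k: "k \<in> {1..n}"
  show "\<mu> k \<in> Q.span (\<mu> ` nonpivots)"
  proof (cases "k \<in> nonpivots")
    case False
    then obtain i where i: "i \<in> {1..r}" "k = m i"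
      using k by (auto simp: nonpivots_def)
    let ?s = "\<Sum>l\<in>{1..n} - {k}. of_rat (of_nat (D i l)) * \<mu> l"
    have "of_rat (of_nat (D i l)) * \<mu> l \<in> Q.span (\<mu> ` nonpivots)" if "l \<in> {1..n} - {k}" for l
    proof (cases "blk l = i")
      case True
      then have "l \<in> nonpivots"
        using that i m_block by (auto simp: nonpivots_def simp del: atLeastAtMost_iff)
      then show ?thesis
        by (intro Q.span_scale Q.span_base) auto
    next
      case False
      then have "D i l = 0"
        using that i by (simp add: D_apply del: atLeastAtMost_iff)
      then show ?thesis
        by (simp add: Q.span_zero)
    qed
    then have "?s \<in> Q.span (\<mu> ` nonpivots)"
      by (rule Q.span_sum)
    then have "of_rat (- 1 / of_nat (d k)) * ?s \<in> Q.span (\<mu> ` nonpivots)"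
      by (rule Q.span_scale)
    moreover have "of_nat (d k) * \<mu> k + ?s = 0"
      using pairing_block[OF i(1)] D_apply[OF i(1) k] m_block[OF i(1)] i(2)
      by (simp add: pairing_def sum.remove[of "{1..n}" k] del: atLeastAtMost_iff One_nat_def)
    then have "of_rat (- 1 / of_nat (d k)) * ?s = \<mu> k"
      using d_pos[OF k]
      by (simp add: of_rat_divide of_rat_minus divide_simps add_eq_0_iff2 mult.commute)
    ultimately show ?thesis
      by simp
  qed (simp add: Q.span_base)
qed

text \<open>Subtracting from \<open>a\<close> the rational combination of the rows
  \<open>D i\<close> that agrees with it at the pivots leaves a relation supported on
  \<open>nonpivots\<close>, which is trivial. Cross-multiplication keeps the conclusion in the
  integers.\<close>

lemma relation_proportional:
  fixes a :: "nat \<Rightarrow> int"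
  assumes rel: "(\<Sum>k=1..n. of_int (a k) * \<mu> k) = 0" and k: "k \<in> {1..n}"
  shows "a k * int (d (m (blk k))) = a (m (blk k)) * int (d k)"
proof -
  define q :: "nat \<Rightarrow> rat" where "q i = of_int (a (m i)) / of_nat (d (m i))" for i
  define c where "c k = of_int (a k) - q (blk k) * of_nat (d k)" for k
  have d_pivot: "d (m (blk l)) > 0" if "l \<in> {1..n}" for l
    using that blk_in(1) m_block d_pos by blast
  have pivot: "c (m i) = 0" if "i \<in> {1..r}" for i
    using that m_block[OF that] d_pos[of "m i"] by (simp add: c_def q_def)
  have "(\<Sum>k=1..n. of_rat (c k) * \<mu> k)
      = (\<Sum>k=1..n. of_int (a k) * \<mu> k) - (\<Sum>k=1..n. of_rat (q (blk k)) * of_nat (d k) * \<mu> k)"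
    by (simp add: c_def of_rat_diff of_rat_mult algebra_simps sum_subtractf)
  then have "(\<Sum>k=1..n. of_rat (c k) * \<mu> k) = 0"
    using rel sum_block_relation[of "\<lambda>i. of_rat (q i)"] by simp
  moreover have "(\<Sum>k\<in>nonpivots. of_rat (c k) * \<mu> k) = (\<Sum>k=1..n. of_rat (c k) * \<mu> k)"
    by (intro sum.mono_neutral_left) (auto simp: nonpivots_def pivot)
  \<comment> \<open>The values at the \<open>n - r\<close> nonpivots span a space of dimension
    \<open>n - r\<close>, so they satisfy no nontrivial rational relation.\<close>
  ultimately have "c k = 0" if "k \<in> nonpivots" for k
    using that mu_in_span_nonpivots dim_span card_nonpivots
    by (intro rational_relation_trivial[of nonpivots \<mu> "{1..n}" c])
      (auto simp: nonpivots_def)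
  then have "c k = 0"
    using k pivot by (cases "k \<in> nonpivots") (auto simp: nonpivots_def)
  then have "of_int (a k) * of_nat (d (m (blk k))) = (of_int (a (m (blk k))) * of_nat (d k) :: rat)"
    using d_pivot[OF k] by (simp add: c_def q_def field_simps)
  then have "(of_int (a k * int (d (m (blk k)))) :: rat) = of_int (a (m (blk k)) * int (d k))"
    by simp
  then show ?thesis
    by (simp only: of_int_eq_iff)
qed

text \<open>At the pivot \<open>p\<close> of a block, proportionality makes \<open>d p\<close>
  divide \<open>a p * d l\<close> for every \<open>l\<close> in the block, hence \<open>a p\<close>
  times the gcd of the block, which is 1. So the rational factor \<open>a p / d p\<close> is an
  integer.\<close>

lemma relation_integral:
  fixes a :: "nat \<Rightarrow> int"
  assumes rel: "(\<Sum>k=1..n. of_int (a k) * \<mu> k) = 0"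
  shows "\<exists>q. \<forall>k\<in>{1..n}. a k = q (blk k) * int (d k)"
proof (intro exI ballI)
  fix k assume k: "k \<in> {1..n}"
  define p where "p = m (blk k)"
  have i: "blk k \<in> {1..r}"
    using k by (rule blk_in)
  have p: "p \<in> {1..n}" "blk p = blk k"
    using m_block[OF i] by (auto simp: p_def)
  have "d p dvd nat \<bar>a p\<bar> * d l" if "l \<in> {m (blk k - 1) + 1..m (blk k)}" for l
  proof -
    have "l \<in> {1..n}" "m (blk l) = p"
      using that block_iff[OF i] by (auto simp: p_def)
    then have "a l * int (d p) = a p * int (d l)"
      using relation_proportional[OF rel, of l] by simp
    then have "int (d p) dvd a p * int (d l)"
      by (metis dvd_triv_right)
    then have "nat \<bar>int (d p)\<bar> dvd nat \<bar>a p * int (d l)\<bar>"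
      by (simp only: nat_abs_dvd_iff dvd_abs_iff nat_0_le abs_ge_zero abs_dvd_iff)
    then show ?thesis
      by (simp add: abs_mult nat_mult_distrib)
  qed
  then have "d p dvd Gcd ((*) (nat \<bar>a p\<bar>) ` d ` {m (blk k - 1) + 1..m (blk k)})"
    by (intro Gcd_greatest) blast
  then have "d p dvd nat \<bar>a p\<bar>"
    using Gcd_block[OF i] by (simp add: Gcd_mult)
  then have dvd: "int (d p) dvd a p"
    by simp
  have "a k * int (d p) = a p div int (d p) * int (d k) * int (d p)"
    using relation_proportional[OF rel k] dvd by (simp add: p_def[symmetric] algebra_simps)
  \<comment> \<open>Expressing the factor through \<open>blk k\<close> lets unification read off the
    witness \<open>\<lambda>i. a (m i) div int (d (m i))\<close>.\<close>
  then show "a k = (a (m (blk k)) div int (d (m (blk k)))) * int (d k)"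
    using d_pos[OF p(1)] by (simp add: p_def)
qed

end

section \<open>Action of a diagonal field on coefficients\<close>

lemma poly_mapping_eq_sum_singles:
  "p = (\<Sum>a\<in>Poly_Mapping.keys p. Poly_Mapping.single a (Poly_Mapping.lookup p a))"
  by (rule poly_mapping_eqI) (simp add: lookup_sum lookup_single when_def in_keys_iff)

lemma lookup_sum_single_keys:
  assumes "\<And>a. a \<notin> Poly_Mapping.keys p \<Longrightarrow> f a = 0"
  shows "Poly_Mapping.lookup (\<Sum>a\<in>Poly_Mapping.keys p. Poly_Mapping.single a (f a)) b = f b"
  using assms by (simp add: lookup_sum lookup_single when_def)

lemma lookup_const_mult: "Poly_Mapping.lookup (const c * p) a = c * Poly_Mapping.lookup p a"
proof -
  have "const c * p = Poly_Mapping.map ((*) c) p"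
    by (simp add: const_def mult_map_scale_conv_mult)
  then show ?thesis
    by (simp add: map.rep_eq when_def)
qed

lemma single_diff_add_single:
  fixes a :: "nat \<Rightarrow>\<^sub>0 nat"
  assumes "Poly_Mapping.lookup a k > 0"
  shows "a - Poly_Mapping.single k 1 + Poly_Mapping.single k 1 = a"
  using assms by (intro poly_mapping_eqI) (auto simp: lookup_add lookup_minus lookup_single when_def)

text \<open>Truncated subtraction would spoil an exponent without \<open>x_k\<close>; in a
  derivative such a term carries the coefficient 0.\<close>

lemma single_mult_var:
  assumes "Poly_Mapping.lookup a k > 0 \<or> c = 0"
  shows "Poly_Mapping.single (a - Poly_Mapping.single k 1) c * var k = Poly_Mapping.single a c"
  using assms single_diff_add_single[of a k] by (auto simp: var_def mult_single)

text \<open>Multiplying by \<open>var k\<close> restores the exponent that the derivative lowered: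
  the Euler operator acts diagonally on monomials.\<close>

lemma lookup_pderiv_mult_var:
  "Poly_Mapping.lookup (pderiv_var k p * var k) b
     = of_nat (Poly_Mapping.lookup b k) * Poly_Mapping.lookup p b"
proof -
  have "pderiv_var k p * var k = (\<Sum>a\<in>Poly_Mapping.keys p.
      Poly_Mapping.single a (of_nat (Poly_Mapping.lookup a k) * Poly_Mapping.lookup p a))"
    unfolding pderiv_var_def sum_distrib_right
    by (intro sum.cong refl single_mult_var) auto
  then show ?thesis
    using lookup_sum_single_keys[of p "\<lambda>a. of_nat (Poly_Mapping.lookup a k) * Poly_Mapping.lookup p a"]
    by (simp add: in_keys_iff)
qed

lemma linear_vfield_diag:
  "linear_vfield n (diag \<mu>) = (\<lambda>k. if k \<in> {1..n} then const (\<mu> k) * var k else 0)"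
proof
  fix i
  have "const (diag \<mu> i j) * var j = (if i = j then const (\<mu> i) * var i else 0)" for j
    by (simp add: diag_def const_def)
  then show "linear_vfield n (diag \<mu>) i = (if i \<in> {1..n} then const (\<mu> i) * var i else 0)"
    by (simp add: linear_vfield_def)
qed

lemma lookup_lie_deriv_diag:
  "Poly_Mapping.lookup (lie_deriv n (linear_vfield n (diag \<mu>)) p) b
     = pairing n (Poly_Mapping.lookup b) \<mu> * Poly_Mapping.lookup p b"
proof -
  have "lie_deriv n (linear_vfield n (diag \<mu>)) p
      = (\<Sum>k=1..n. const (\<mu> k) * (pderiv_var k p * var k))"
    unfolding lie_deriv_def linear_vfield_diag by (intro sum.cong refl) (simp add: algebra_simps)
  then show ?thesis
    by (simp add: lookup_sum lookup_const_mult lookup_pderiv_mult_var pairing_def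
        sum_distrib_right mult.left_commute mult.commute[of "\<mu> _"] mult.assoc)
qed

lemma pderiv_var_const_mult_var:
  "pderiv_var k (const c * var i) = (if k = i then const c else 0)"
proof -
  have "pderiv_var k (Poly_Mapping.single (Poly_Mapping.single i 1) c)
      = (if k = i then Poly_Mapping.single 0 c else 0)"
    by (cases "c = 0") (auto simp: pderiv_var_def lookup_single when_def)
  then show ?thesis
    by (simp add: const_def var_def mult_single)
qed

text \<open>Only one partial derivative of \<open>\<mu> i\<close> times \<open>x_i\<close> survives.
  This yields the second term of the Lie bracket.\<close>

lemma lie_deriv_linear_vfield_diag:
  assumes "i \<in> {1..n}"
  shows "lie_deriv n h (linear_vfield n (diag \<mu>) i) = const (\<mu> i) * h i"
  using assms
  by (simp add: lie_deriv_def linear_vfield_diag pderiv_var_const_mult_var if_distrib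
      if_distribR sum.delta' cong: if_cong)

lemma lie_deriv_zero: "lie_deriv n h 0 = 0"
  by (simp add: lie_deriv_def pderiv_var_def)

section \<open>Weight spaces\<close>

text \<open>Inside \<open>polys n\<close> this is the eigenspace of the derivation along
  \<open>diag \<mu>\<close> for the eigenvalue \<open>w\<close>, phrased by exponents so that
  products and division by a variable are easy to follow.\<close>

definition weight_space :: "nat \<Rightarrow> (nat \<Rightarrow> complex) \<Rightarrow> complex \<Rightarrow> cpoly set" where
  "weight_space n \<mu> w =
     {p \<in> polys n. \<forall>a\<in>Poly_Mapping.keys p. pairing n (Poly_Mapping.lookup a) \<mu> = w}"

lemma first_integrals_diag: "first_integrals n (diag \<mu>) = weight_space n \<mu> 0"
  unfolding first_integrals_def weight_space_def
  by (auto simp: poly_mapping_eq_iff fun_eq_iff lookup_lie_deriv_diag in_keys_iff)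

text \<open>Entry \<open>k\<close> of the bracket is the derivative of \<open>g k\<close> along the
  diagonal field minus \<open>\<mu> k\<close> times \<open>g k\<close>, so it vanishes exactly when
  \<open>g k\<close> has weight \<open>\<mu> k\<close>.\<close>

lemma pol_centralizer_diag:
  "pol_centralizer n (diag \<mu>) =
     {g. (\<forall>k\<in>{1..n}. g k \<in> weight_space n \<mu> (\<mu> k)) \<and> (\<forall>k. k \<notin> {1..n} \<longrightarrow> g k = 0)}"
proof -
  have "lie_bracket n (linear_vfield n (diag \<mu>)) g = (\<lambda>_. 0) \<longleftrightarrow>
      (\<forall>k\<in>{1..n}. \<forall>a\<in>Poly_Mapping.keys (g k). pairing n (Poly_Mapping.lookup a) \<mu> = \<mu> k)"
    if g: "g \<in> vfields n" for g
  proof -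
    have out: "lie_bracket n (linear_vfield n (diag \<mu>)) g k = 0" if "k \<notin> {1..n}" for k
      using g that
      by (simp add: vfields_def lie_bracket_def linear_vfield_diag lie_deriv_zero
          del: atLeastAtMost_iff)
    have "lie_bracket n (linear_vfield n (diag \<mu>)) g k = 0 \<longleftrightarrow>
      (\<forall>a\<in>Poly_Mapping.keys (g k). pairing n (Poly_Mapping.lookup a) \<mu> = \<mu> k)"
      if "k \<in> {1..n}" for k
      using that
      by (auto simp: lie_bracket_def lie_deriv_linear_vfield_diag poly_mapping_eq_iff fun_eq_iff
          lookup_minus lookup_lie_deriv_diag lookup_const_mult in_keys_iff simp del: atLeastAtMost_iff)
    then show ?thesis
      using out by (metis ext)
  qed
  then show ?thesis
    by (auto simp: pol_centralizer_def weight_space_def vfields_def simp del: atLeastAtMost_iff)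
qed

lemma pairing_lookup_add:
  "pairing n (Poly_Mapping.lookup (a + b)) \<mu>
     = pairing n (Poly_Mapping.lookup a) \<mu> + pairing n (Poly_Mapping.lookup b) \<mu>"
  by (simp add: pairing_def lookup_add algebra_simps sum.distrib)

lemma pairing_lookup_single:
  "k \<in> {1..n} \<Longrightarrow> pairing n (Poly_Mapping.lookup (Poly_Mapping.single k 1)) \<mu> = \<mu> k"
proof -
  assume "k \<in> {1..n}"
  moreover have "pairing n (Poly_Mapping.lookup (Poly_Mapping.single k 1)) \<mu>
      = (\<Sum>l=1..n. if l = k then \<mu> k else 0)"
    unfolding pairing_def by (intro sum.cong refl) (simp add: lookup_single)
  ultimately show ?thesis
    by simp
qed

lemma weight_space_add:
  "p \<in> weight_space n \<mu> w \<Longrightarrow> q \<in> weight_space n \<mu> w \<Longrightarrow> p + q \<in> weight_space n \<mu> w"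
  using keys_add[of p q] unfolding weight_space_def polys_def by blast

lemma weight_space_mult:
  assumes "p \<in> weight_space n \<mu> v" "q \<in> weight_space n \<mu> w"
  shows "p * q \<in> weight_space n \<mu> (v + w)"
proof -
  have "Poly_Mapping.keys c \<subseteq> {1..n} \<and> pairing n (Poly_Mapping.lookup c) \<mu> = v + w"
    if "c \<in> Poly_Mapping.keys (p * q)" for c
  proof -
    obtain a b where "c = a + b" "a \<in> Poly_Mapping.keys p" "b \<in> Poly_Mapping.keys q"
      using \<open>c \<in> Poly_Mapping.keys (p * q)\<close> keys_mult by blast
    then show ?thesis
      using assms keys_add[of a b] by (fastforce simp: weight_space_def polys_def pairing_lookup_add)
  qed
  then show ?thesis
    by (auto simp: weight_space_def polys_def simp del: atLeastAtMost_iff)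
qed

lemma single_in_weight_space:
  assumes "Poly_Mapping.keys a \<subseteq> {1..n}" "pairing n (Poly_Mapping.lookup a) \<mu> = w"
  shows "Poly_Mapping.single a c \<in> weight_space n \<mu> w"
  using assms by (auto simp: weight_space_def polys_def)

lemma const_in_weight_space: "const c \<in> weight_space n \<mu> 0"
  unfolding const_def by (rule single_in_weight_space) (auto simp: pairing_def)

lemma var_in_weight_space: "k \<in> {1..n} \<Longrightarrow> var k \<in> weight_space n \<mu> (\<mu> k)"
  unfolding var_def by (rule single_in_weight_space) (auto simp: pairing_lookup_single simp del: One_nat_def)

lemma zero_in_weight_space: "0 \<in> weight_space n \<mu> w"
  by (simp add: weight_space_def polys_def)

lemma weight_space_sum:
  "(\<And>x. x \<in> X \<Longrightarrow> f x \<in> weight_space n \<mu> w) \<Longrightarrow> sum f X \<in> weight_space n \<mu> w"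
  by (induction X rule: infinite_finite_induct) (auto intro: weight_space_add zero_in_weight_space)

text \<open>Positive exponents allow \<open>x_k\<close> to be cancelled term by term; each weight
  then drops by that of \<open>x_k\<close>.\<close>

lemma weight_space_divide_var:
  assumes p: "p \<in> weight_space n \<mu> w" and k: "k \<in> {1..n}"
    and pos: "\<And>a. a \<in> Poly_Mapping.keys p \<Longrightarrow> Poly_Mapping.lookup a k > 0"
  obtains q where "q \<in> weight_space n \<mu> (w - \<mu> k)" "p = q * var k"
proof
  let ?q = "\<Sum>a\<in>Poly_Mapping.keys p.
    Poly_Mapping.single (a - Poly_Mapping.single k 1) (Poly_Mapping.lookup p a)"
  show "?q \<in> weight_space n \<mu> (w - \<mu> k)"
  proof (intro weight_space_sum single_in_weight_space)
    fix a assume a: "a \<in> Poly_Mapping.keys p"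
    let ?b = "a - Poly_Mapping.single k 1"
    have "Poly_Mapping.keys ?b \<subseteq> Poly_Mapping.keys a"
      by (auto simp: in_keys_iff lookup_minus)
    then show "Poly_Mapping.keys ?b \<subseteq> {1..n}"
      using p a by (auto simp: weight_space_def polys_def)
    have "pairing n (Poly_Mapping.lookup ?b) \<mu> + \<mu> k = pairing n (Poly_Mapping.lookup a) \<mu>"
      using pairing_lookup_add[of n ?b "Poly_Mapping.single k 1" \<mu>] single_diff_add_single[OF pos[OF a]]
        pairing_lookup_single[OF k] by simp
    then show "pairing n (Poly_Mapping.lookup ?b) \<mu> = w - \<mu> k"
      using p a by (simp add: weight_space_def eq_diff_eq)
  qed
  have "?q * var k = (\<Sum>a\<in>Poly_Mapping.keys p. Poly_Mapping.single a (Poly_Mapping.lookup p a))"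
    unfolding sum_distrib_right using pos by (intro sum.cong refl single_mult_var) auto
  then show "p = ?q * var k"
    using poly_mapping_eq_sum_singles[of p] by simp
qed

section \<open>Monomials and the algebra they generate\<close>

definition exponent :: "nat \<Rightarrow> (nat \<Rightarrow> nat) \<Rightarrow> (nat \<Rightarrow>\<^sub>0 nat)" where
  "exponent n e = (\<Sum>k=1..n. Poly_Mapping.single k (e k))"

lemma lookup_exponent: "Poly_Mapping.lookup (exponent n e) k = (if k \<in> {1..n} then e k else 0)"
  by (simp add: exponent_def lookup_sum lookup_single when_def)

lemma keys_exponent: "Poly_Mapping.keys (exponent n e) \<subseteq> {1..n}"
  by (auto simp: in_keys_iff lookup_exponent split: if_splits)

lemma monomial_eq_single: "monomial n e = Poly_Mapping.single (exponent n e) 1"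
proof -
  have "var k ^ j = Poly_Mapping.single (Poly_Mapping.single k j) 1" for k j
  proof (induction j)
    case (Suc j)
    then show ?case
      by (simp add: var_def mult_single flip: single_add)
  qed simp
  moreover have "(\<Prod>k\<in>A. Poly_Mapping.single (Poly_Mapping.single k (e k)) (1::complex))
      = Poly_Mapping.single (\<Sum>k\<in>A. Poly_Mapping.single k (e k)) 1" if "finite A" for A
    using that by induction (auto simp: mult_single)
  ultimately show ?thesis
    by (simp add: monomial_def exponent_def)
qed

text \<open>The exponent law that will turn a combination of block rows into a product of powers of
  the \<open>monomial n (D i)\<close>.\<close>

lemma monomial_sum:
  "monomial n (\<lambda>k. \<Sum>i\<in>A. b i * e i k) = (\<Prod>i\<in>A. monomial n (e i) ^ b i)"
proof -
  have "monomial n (\<lambda>k. \<Sum>i\<in>A. b i * e i k) = (\<Prod>k=1..n. \<Prod>i\<in>A. (var k ^ e i k) ^ b i)"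
    by (simp add: monomial_def power_sum mult.commute[of "b _"] power_mult)
  also have "\<dots> = (\<Prod>i\<in>A. monomial n (e i) ^ b i)"
    by (subst prod.swap) (simp add: monomial_def prod_power_distrib)
  finally show ?thesis .
qed

lemma pairing_exponent: "pairing n (Poly_Mapping.lookup (exponent n e)) \<mu> = pairing n e \<mu>"
  unfolding pairing_def by (intro sum.cong refl) (simp add: lookup_exponent)

lemma generated_algebra_sum:
  "(\<And>x. x \<in> X \<Longrightarrow> f x \<in> generated_algebra S) \<Longrightarrow> sum f X \<in> generated_algebra S"
proof (induction X rule: infinite_finite_induct)
  case (insert x X)
  then show ?case
    by (auto intro: generated_algebra.add)
qed (use generated_algebra.const[of 0 S] in \<open>auto simp: const_def\<close>)

lemma generated_algebra_one: "1 \<in> generated_algebra S"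
  using generated_algebra.const[of 1 S] by (simp add: const_def)

lemma generated_algebra_power:
  "p \<in> generated_algebra S \<Longrightarrow> p ^ j \<in> generated_algebra S"
  by (induction j) (auto intro: generated_algebra.mult generated_algebra_one)

lemma generated_algebra_prod:
  "(\<And>x. x \<in> X \<Longrightarrow> f x \<in> generated_algebra S) \<Longrightarrow> prod f X \<in> generated_algebra S"
  by (induction X rule: infinite_finite_induct)
    (auto intro: generated_algebra.mult generated_algebra_one)

section \<open>Modules generated by fields along the coordinate axes\<close>

text \<open>Choosing \<open>w = var\<close> gives \<open>Q_field\<close>; a free choice of
  \<open>w\<close> also admits the constant fields \<open>e_k\<close>.\<close>

definition axis_field :: "(nat \<Rightarrow> cpoly) \<Rightarrow> nat \<Rightarrow> vfield" where
  "axis_field w j = (\<lambda>k. if k = j then w j else 0)"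

lemma sum_axis_fields:
  assumes inj: "inj_on (axis_field w) J" and J: "finite J"
  shows "(\<Sum>s\<in>axis_field w ` J. c s * s k) = (if k \<in> J then c (axis_field w k) * w k else 0)"
proof -
  have "(\<Sum>s\<in>axis_field w ` J. c s * s k)
      = (\<Sum>j\<in>J. if k = j then c (axis_field w j) * w j else 0)"
    unfolding sum.reindex[OF inj] by (intro sum.cong refl) (simp add: axis_field_def)
  then show ?thesis
    using J by simp
qed

lemma inj_axis_field:
  assumes "\<And>j. w j \<noteq> 0"
  shows "inj (axis_field w)"
  using assms by (metis axis_field_def injI)

text \<open>Nonvanishing of \<open>w\<close> makes the fields distinct, so sums over fields become
  sums over indices with at most one term per entry. Membership of 0 in \<open>R\<close> supplies
  coefficients for fields absent from a combination.\<close>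

lemma generated_module_axis_fields:
  assumes w: "\<And>j. w j \<noteq> 0" and R: "0 \<in> R"
  shows "generated_module R (axis_field w ` {1..n}) =
    {g. (\<forall>k\<in>{1..n}. \<exists>c\<in>R. g k = c * w k) \<and> (\<forall>k. k \<notin> {1..n} \<longrightarrow> g k = 0)}" (is "?L = ?R")
proof (intro equalityI subsetI)
  note inj = inj_on_subset[OF inj_axis_field[OF w] subset_UNIV]
  {
    fix g assume "g \<in> ?L"
    then obtain c T where g: "g = (\<lambda>k. \<Sum>s\<in>T. c s * s k)"
      and T: "finite T" "T \<subseteq> axis_field w ` {1..n}" "\<forall>s\<in>T. c s \<in> R"
      unfolding generated_module_def by blast
    obtain J where J: "J \<subseteq> {1..n}" "T = axis_field w ` J"
      using T(2) by (meson subset_imageE)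
    have g: "g k = (if k \<in> J then c (axis_field w k) * w k else 0)" for k
      unfolding g J(2) using J(1) by (intro sum_axis_fields inj) (rule finite_subset, auto)
    show "g \<in> ?R"
    proof safe
      fix k
      show "\<exists>c\<in>R. g k = c * w k"
        using g[of k] T(3) J(2) R by (cases "k \<in> J") auto
    next
      fix k assume "k \<notin> {1..n}"
      then show "g k = 0"
        using g[of k] J(1) by auto
    qed
  next
    fix g assume g: "g \<in> ?R"
    then obtain c where c: "\<And>k. k \<in> {1..n} \<Longrightarrow> c k \<in> R \<and> g k = c k * w k"
      unfolding mem_Collect_eq by metis
    \<comment> \<open>Coefficients in \<open>generated_module\<close> are attached to fields, not to
      indices; injectivity recovers the index.\<close>
    let ?c = "c \<circ> inv (axis_field w)"
    have inv: "inv (axis_field w) (axis_field w k) = k" for k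
      using inj_axis_field[of w] w by (simp add: inv_f_f)
    have "g = (\<lambda>k. \<Sum>s\<in>axis_field w ` {1..n}. ?c s * s k)"
      using g c by (auto simp: sum_axis_fields[OF inj] inv fun_eq_iff simp del: atLeastAtMost_iff)
    moreover have "\<forall>s\<in>axis_field w ` {1..n}. ?c s \<in> R"
      using c by (auto simp: inv simp del: atLeastAtMost_iff)
    ultimately show "g \<in> ?L"
      unfolding generated_module_def by blast
  }
qed

text \<open>Entry \<open>j\<close> of a relation is the single term \<open>c s * w j\<close>, and
  polynomials have no zero divisors.\<close>

lemma lin_independent_axis_fields:
  assumes w: "\<And>j. w j \<noteq> 0"
  shows "lin_independent R (axis_field w ` {1..n})"
  unfolding lin_independent_def
proof safe
  note inj = inj_on_subset[OF inj_axis_field[OF w] subset_UNIV]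
  fix T c s
  assume T: "finite T" "T \<subseteq> axis_field w ` {1..n}" and s: "s \<in> T"
    and zero: "\<forall>k. (\<Sum>s\<in>T. c s * s k) = 0"
  obtain J where J: "J \<subseteq> {1..n}" "T = axis_field w ` J"
    using T(2) by (meson subset_imageE)
  then obtain j where j: "j \<in> J" "s = axis_field w j"
    using s by blast
  have "finite J"
    using J(1) by (rule finite_subset) simp
  then have "c s * w j = 0"
    using zero[rule_format, of j] J(2) j by (simp add: sum_axis_fields[OF inj])
  then show "c s = 0"
    using w by simp
qed

section \<open>First integrals and centralizer of the resonant diagonal field\<close>

context resonance
begin

text \<open>Relations have integer multipliers by \<open>relation_integral\<close>; the entries of
  an exponent are nonnegative and \<open>d\<close> is positive, so the multipliers are nonnegative
  and \<open>nat\<close> loses nothing.\<close>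

lemma exponent_of_relation:
  fixes a :: "nat \<Rightarrow>\<^sub>0 nat"
  assumes keys: "Poly_Mapping.keys a \<subseteq> {1..n}" and rel: "pairing n (Poly_Mapping.lookup a) \<mu> = 0"
  shows "\<exists>b. a = exponent n (\<lambda>k. \<Sum>i=1..r. b i * D i k)"
proof -
  have "(\<Sum>k=1..n. of_int (int (Poly_Mapping.lookup a k)) * \<mu> k) = 0"
    using rel by (simp add: pairing_def)
  then obtain q where
    q: "\<And>k. k \<in> {1..n} \<Longrightarrow> int (Poly_Mapping.lookup a k) = q (blk k) * int (d k)"
    using relation_integral by meson
  have lookup: "Poly_Mapping.lookup a k = nat (q (blk k)) * d k" if "k \<in> {1..n}" for k
  proof -
    have "0 \<le> q (blk k)"
      using q[OF that] d_pos[OF that]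
      by (metis of_nat_0_le_iff of_nat_0_less_iff zero_le_mult_iff not_less)
    then have "int (Poly_Mapping.lookup a k) = int (nat (q (blk k)) * d k)"
      using q[OF that] by simp
    then show ?thesis
      by (simp only: of_nat_eq_iff)
  qed
  have "a = exponent n (\<lambda>k. \<Sum>i=1..r. nat (q i) * D i k)"
  proof (rule poly_mapping_eqI)
    fix k
    show "Poly_Mapping.lookup a k
        = Poly_Mapping.lookup (exponent n (\<lambda>k. \<Sum>i=1..r. nat (q i) * D i k)) k"
    proof (cases "k \<in> {1..n}")
      case True
      then show ?thesis
        using sum_D[OF True, of "\<lambda>i. nat (q i)"] lookup[OF True] by (simp add: lookup_exponent)
    next
      case False
      then show ?thesis
        using keys by (auto simp: lookup_exponent in_keys_iff)
    qed
  qed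
  then show ?thesis
    by (intro exI)
qed

text \<open>By \<open>exponent_of_relation\<close>, each term of a first integral is a constant
  times a product of powers of generators. Conversely, weight 0 holds for constants and generators
  and persists under sums and products.\<close>

theorem first_integrals_generated:
  "first_integrals n (diag \<mu>) = generated_algebra ((\<lambda>i. monomial n (D i)) ` {1..r})"
  (is "_ = generated_algebra ?S")
  unfolding first_integrals_diag
proof (intro equalityI subsetI)
  fix p assume p: "p \<in> weight_space n \<mu> 0"
  have "Poly_Mapping.single a c \<in> generated_algebra ?S" if a: "a \<in> Poly_Mapping.keys p" for a c
  proof -
    obtain b where "a = exponent n (\<lambda>k. \<Sum>i=1..r. b i * D i k)"
      using p a exponent_of_relation unfolding weight_space_def polys_def by blast
    then have "Poly_Mapping.single a c = const c * (\<Prod>i=1..r. monomial n (D i) ^ b i)"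
      unfolding monomial_sum[symmetric] by (simp add: const_def mult_single monomial_eq_single)
    also have "\<dots> \<in> generated_algebra ?S"
      by (intro generated_algebra.mult generated_algebra.const generated_algebra_prod
          generated_algebra_power generated_algebra.gen) auto
    finally show ?thesis .
  qed
  then show "p \<in> generated_algebra ?S"
    by (subst poly_mapping_eq_sum_singles) (intro generated_algebra_sum)
next
  fix p assume "p \<in> generated_algebra ?S"
  then show "p \<in> weight_space n \<mu> 0"
  proof induction
    case (gen p)
    then obtain i where i: "i \<in> {1..r}" "p = monomial n (D i)"
      by blast
    show ?case
      unfolding i(2) monomial_eq_single
      by (intro single_in_weight_space keys_exponent) (simp add: pairing_exponent pairing_block[OF i(1)])
  next
    case (mult p q)
    then show ?case
      using weight_space_mult[of p n \<mu> 0 q 0] by simp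
  qed (auto intro: const_in_weight_space weight_space_add)
qed

text \<open>Substitution sends the monomial with exponent \<open>a\<close> to the one with exponent
  \<open>E a\<close>. Since \<open>E\<close> is injective on the exponents of \<open>p\<close>,
  distinct terms cannot cancel.\<close>

theorem alg_independent_block_monomials: "alg_independent r (\<lambda>i. monomial n (D i))"
  unfolding alg_independent_def
proof (intro ballI impI)
  fix p assume p: "p \<in> polys r" and zero: "subst_poly r (\<lambda>i. monomial n (D i)) p = 0"
  define E where "E a = exponent n (\<lambda>k. \<Sum>i=1..r. Poly_Mapping.lookup a i * D i k)" for a
  have subst: "subst_poly r (\<lambda>i. monomial n (D i)) p
      = (\<Sum>a\<in>Poly_Mapping.keys p. Poly_Mapping.single (E a) (Poly_Mapping.lookup p a))"
    unfolding subst_poly_def E_def monomial_sum[symmetric]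
    by (simp add: const_def mult_single monomial_eq_single)
  \<comment> \<open>At the pivot of block \<open>i\<close> only row \<open>i\<close> is nonzero, so
    \<open>a\<close> can be read off from \<open>E a\<close>.\<close>
  have E: "Poly_Mapping.lookup (E a) (m i) = Poly_Mapping.lookup a i * d (m i)"
    if "i \<in> {1..r}" for a i
    using m_block[OF that] sum_D[of "m i" "Poly_Mapping.lookup a"] by (simp add: E_def lookup_exponent)
  have inj: "inj_on E (Poly_Mapping.keys p)"
  proof (intro inj_onI poly_mapping_eqI)
    fix a b i
    assume ab: "a \<in> Poly_Mapping.keys p" "b \<in> Poly_Mapping.keys p" "E a = E b"
    show "Poly_Mapping.lookup a i = Poly_Mapping.lookup b i"
    proof (cases "i \<in> {1..r}")
      case True
      then show ?thesis
        using E[OF True, of a] E[OF True, of b] ab(3) m_block[OF True] d_pos[of "m i"] by simp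
    next
      case False
      then have "i \<notin> Poly_Mapping.keys a" "i \<notin> Poly_Mapping.keys b"
        using p ab(1,2) unfolding polys_def by blast+
      then show ?thesis
        by (simp add: in_keys_iff)
    qed
  qed
  have "Poly_Mapping.lookup p b = 0" if b: "b \<in> Poly_Mapping.keys p" for b
  proof -
    \<comment> \<open>The coefficient of the substituted polynomial at \<open>E b\<close>;
      injectivity will leave only the term of \<open>b\<close>.\<close>
    have "0 = (\<Sum>a\<in>Poly_Mapping.keys p. Poly_Mapping.lookup p a when E a = E b)"
      using zero subst by (metis (no_types, lifting) lookup_single lookup_sum lookup_zero sum.cong)
    also have "\<dots> = (\<Sum>a\<in>Poly_Mapping.keys p. if a = b then Poly_Mapping.lookup p a else 0)"
      using inj b by (intro sum.cong refl) (auto simp: when_def inj_on_eq_iff)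
    also have "\<dots> = Poly_Mapping.lookup p b"
      using b by simp
    finally show ?thesis
      by simp
  qed
  then show "p = 0"
    by (metis in_keys_iff lookup_zero poly_mapping_eqI)
qed

text \<open>If \<^term>\<open>k\<close> is alone in its block then \<open>\<mu> k = 0\<close>, so \<open>e\<^sub>k\<close> replaces \<open>x\<^sub>k e\<^sub>k\<close> in the basis
  of the centralizer.\<close>

definition basis_coeff :: "nat \<Rightarrow> cpoly" where
  "basis_coeff k = (if m (blk k - 1) + 1 = m (blk k) then 1 else var k)"

lemma basis_coeff_nonzero: "basis_coeff k \<noteq> 0"
  by (simp add: basis_coeff_def var_def)
    (metis lookup_single_eq lookup_zero zero_neq_one)

lemma singleton_block:
  assumes k: "k \<in> {1..n}" and single: "m (blk k - 1) + 1 = m (blk k)"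
  shows "\<mu> k = 0"
proof -
  have "{m (blk k - 1) + 1..m (blk k)} = {k}"
    using blk_in(2)[OF k] single by auto
  then have "D (blk k) l = (if l = k then d k else 0)" for l
    by (auto simp: block_row_apply)
  then have "pairing n (D (blk k)) \<mu> = (\<Sum>l=1..n. if l = k then of_nat (d k) * \<mu> k else 0)"
    unfolding pairing_def by (intro sum.cong refl) simp
  then have "of_nat (d k) * \<mu> k = 0"
    using pairing_block[OF blk_in(1)[OF k]] k by simp
  then show ?thesis
    using d_pos[OF k] by simp
qed

text \<open>On the block of \<open>k\<close>, the entries of \<open>a - e_k\<close> are an integer
  \<open>q\<close> times the positive \<open>d\<close>. If \<open>a\<close> vanished at
  \<open>k\<close>, the entry -1 there would force \<open>q < 0\<close>, while another index of the
  block has an entry \<ge> 0.\<close>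

lemma exponent_positive:
  assumes k: "k \<in> {1..n}" and nonsingle: "m (blk k - 1) + 1 \<noteq> m (blk k)"
    and rel: "pairing n (Poly_Mapping.lookup a) \<mu> = \<mu> k"
  shows "Poly_Mapping.lookup a k > 0"
proof (rule ccontr)
  assume neg: "\<not> Poly_Mapping.lookup a k > 0"
  have "\<exists>l\<in>{m (blk k - 1) + 1..m (blk k)}. l \<noteq> k"
    using blk_in(2)[OF k] nonsingle
    by (metis atLeastAtMost_iff le_refl le_trans)
  then obtain l where "l \<in> {m (blk k - 1) + 1..m (blk k)}" "l \<noteq> k"
    by blast
  then have l: "l \<in> {1..n}" "blk l = blk k" "l \<noteq> k"
    using block_iff[OF blk_in(1)[OF k]] by auto
  let ?a = "\<lambda>j. int (Poly_Mapping.lookup a j) - (if j = k then 1 else 0)"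
  have "(\<Sum>j=1..n. of_int (?a j) * \<mu> j)
      = pairing n (Poly_Mapping.lookup a) \<mu> - (\<Sum>j=1..n. if j = k then \<mu> j else 0)"
    unfolding pairing_def sum_subtractf[symmetric] by (intro sum.cong refl) (simp add: algebra_simps)
  then have "(\<Sum>j=1..n. of_int (?a j) * \<mu> j) = 0"
    using rel k by simp
  then obtain q where q: "\<And>j. j \<in> {1..n} \<Longrightarrow> ?a j = q (blk j) * int (d j)"
    using relation_integral by meson
  have "q (blk k) * int (d k) < 0"
    using q[OF k] neg by simp
  then have "q (blk k) < 0"
    by (simp add: mult_less_0_iff)
  moreover have "q (blk k) * int (d l) \<ge> 0"
    using q[OF l(1)] l(2,3) by (metis diff_0_right of_nat_0_le_iff)
  ultimately show False
    using d_pos[OF l(1)] by (simp add: zero_le_mult_iff)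
qed

text \<open>In a one-element block \<open>\<mu> k = 0\<close> and the basis coefficient is 1, so
  both sides agree; otherwise \<open>x_k\<close> divides every term and can be cancelled.\<close>

lemma weight_space_mu:
  assumes k: "k \<in> {1..n}"
  shows "p \<in> weight_space n \<mu> (\<mu> k) \<longleftrightarrow> (\<exists>c\<in>weight_space n \<mu> 0. p = c * basis_coeff k)"
proof (cases "m (blk k - 1) + 1 = m (blk k)")
  case True
  then show ?thesis
    using singleton_block[OF k] by (simp add: basis_coeff_def)
next
  case False
  show ?thesis
  proof
    assume p: "p \<in> weight_space n \<mu> (\<mu> k)"
    then have "Poly_Mapping.lookup a k > 0" if "a \<in> Poly_Mapping.keys p" for a
      using that exponent_positive[OF k False] by (simp add: weight_space_def)
    then show "\<exists>c\<in>weight_space n \<mu> 0. p = c * basis_coeff k"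
      using weight_space_divide_var[OF p k] False by (auto simp: basis_coeff_def)
  next
    assume "\<exists>c\<in>weight_space n \<mu> 0. p = c * basis_coeff k"
    then show "p \<in> weight_space n \<mu> (\<mu> k)"
      using weight_space_mult[of _ n \<mu> 0 "var k" "\<mu> k"] var_in_weight_space[OF k] False
      by (auto simp: basis_coeff_def)
  qed
qed

theorem pol_centralizer_generated:
  "pol_centralizer n (diag \<mu>) =
     generated_module (first_integrals n (diag \<mu>)) (axis_field basis_coeff ` {1..n})"
  unfolding first_integrals_diag pol_centralizer_diag
  by (subst generated_module_axis_fields)
    (auto simp: basis_coeff_nonzero zero_in_weight_space weight_space_mu simp del: atLeastAtMost_iff)

theorem pol_centralizer_free:
  "free_module (first_integrals n (diag \<mu>)) (pol_centralizer n (diag \<mu>))"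
  unfolding free_module_def
  using pol_centralizer_generated lin_independent_axis_fields basis_coeff_nonzero by blast

text \<open>Links the adapted basis to the fields \<open>x_j e_j\<close> once one-element blocks are
  excluded.\<close>

lemma axis_field_eq_Q_field:
  assumes "\<And>i. i \<in> {1..r} \<Longrightarrow> m (i - 1) + 1 < m i" and "k \<in> {1..n}"
  shows "axis_field basis_coeff k = Q_field k"
  using assms(1)[OF blk_in(1)[OF assms(2)]]
  by (simp add: axis_field_def Q_field_def basis_coeff_def fun_eq_iff)

end

text \<open>Generation by the \<open>Q_field j\<close> is claimed only when every block has at least
  two indices: a one-element block \<open>{k}\<close> puts the constant field \<open>e_k\<close>
  into the centralizer. Freeness is unconditional, by way of the adapted basis.\<close>

theorem proposition11:
  fixes r n :: nat and m d :: "nat \<Rightarrow> nat" and \<mu> :: "nat \<Rightarrow> complex"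
  assumes "r > 1"
    and "m 0 = 0" and "\<And>i. i < r \<Longrightarrow> m i < m (Suc i)" and "m r = n"
    and "\<And>k. k \<in> {1..n} \<Longrightarrow> d k > 0"
    and "\<And>i. i \<in> {1..r} \<Longrightarrow> Gcd (d ` {m (i - 1) + 1..m i}) = 1"
    and "\<And>i. i \<in> {1..r} \<Longrightarrow> pairing n (block_row m d i) \<mu> = 0"
    and "Q.dim (Q.span (\<mu> ` {1..n})) = n - r"
  shows
    "first_integrals n (diag \<mu>) =
       generated_algebra ((\<lambda>i. monomial n (block_row m d i)) ` {1..r}) \<and>
     alg_independent r (\<lambda>i. monomial n (block_row m d i)) \<and>
     ((\<forall>i\<in>{1..r}. m (i - 1) + 1 < m i) \<longrightarrow>
        pol_centralizer n (diag \<mu>) =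
          generated_module (first_integrals n (diag \<mu>)) (Q_field ` {1..n})) \<and>
     free_module (first_integrals n (diag \<mu>)) (pol_centralizer n (diag \<mu>))"
proof -
  interpret resonance r n m d \<mu>
    using assms(2-) by unfold_locales
  have "axis_field basis_coeff ` {1..n} = Q_field ` {1..n}"
    if "\<forall>i\<in>{1..r}. m (i - 1) + 1 < m i"
    using that by (intro image_cong refl axis_field_eq_Q_field) auto
  then show ?thesis
    using first_integrals_generated alg_independent_block_monomials pol_centralizer_generated
      pol_centralizer_free by auto
qed

end
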